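(* For all cardinals $m,n$ with $3\le m,n\le\omega$, the class of $(m,n)$-representable posets is not finitely axiomatizable; that is, there is no finite set of first-order sentences in the language of posets (one binary relation symbol $\le$) whose models are exactly the $(m,n)$-representable posets.
   Context: Let $\alpha,\beta$ be cardinals. A poset $P$ is $(\alpha,\beta)$-representable if there is a field of sets $F$ (a family of subsets of some set $X$ closed under finite unions, finite intersections and complements in $X$) and a one-to-one map $h:P\to F$ such that: (1) whenever $S\subseteq P$ with $|S|<\alpha$ and $\bigwedge S$ exists in $P$, then $h(\bigwedge S)=\bigcap h[S]$; (2) whenever $T\subseteq P$ with $|T|<\beta$ and $\bigvee T$ exists in $P$, then $h(\bigvee T)=\bigcup h[T]$. (The intersection of the empty family is read as $X$.) *)

theory Defs
  imports "HOL-Analysis.Sigma_Algebra"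
begin

unbundle cardinal_syntax

section \<open>First-order logic in the language of posets\<close>

text \<open>Formulas over one binary relation symbol, with equality and named variables.\<close>

datatype poset_fm =
    Leq nat nat
  | Equal nat nat
  | Neg poset_fm
  | Conj poset_fm poset_fm
  | Forall nat poset_fm

primrec free_vars :: "poset_fm \<Rightarrow> nat set" where
  "free_vars (Leq x y) = {x, y}"
| "free_vars (Equal x y) = {x, y}"
| "free_vars (Neg \<phi>) = free_vars \<phi>"
| "free_vars (Conj \<phi> \<psi>) = free_vars \<phi> \<union> free_vars \<psi>"
| "free_vars (Forall x \<phi>) = free_vars \<phi> - {x}"

definition sentence :: "poset_fm \<Rightarrow> bool" where
  "sentence \<phi> \<longleftrightarrow> free_vars \<phi> = {}"

primrec sat :: "'a set \<Rightarrow> 'a rel \<Rightarrow> (nat \<Rightarrow> 'a) \<Rightarrow> poset_fm \<Rightarrow> bool" where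
  "sat A r v (Leq x y) \<longleftrightarrow> (v x, v y) \<in> r"
| "sat A r v (Equal x y) \<longleftrightarrow> v x = v y"
| "sat A r v (Neg \<phi>) \<longleftrightarrow> \<not> sat A r v \<phi>"
| "sat A r v (Conj \<phi> \<psi>) \<longleftrightarrow> sat A r v \<phi> \<and> sat A r v \<psi>"
| "sat A r v (Forall x \<phi>) \<longleftrightarrow> (\<forall>a\<in>A. sat A r (v(x := a)) \<phi>)"

definition models :: "'a set \<Rightarrow> 'a rel \<Rightarrow> poset_fm \<Rightarrow> bool" where
  "models A r \<phi> \<longleftrightarrow> (\<forall>v. range v \<subseteq> A \<longrightarrow> sat A r v \<phi>)"

definition fo_structure :: "'a set \<Rightarrow> 'a rel \<Rightarrow> bool" where
  "fo_structure A r \<longleftrightarrow> A \<noteq> {} \<and> r \<subseteq> A \<times> A"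

text \<open>
  A class of structures is given by a predicate on carriers and relations, relative to a
  universe type from whose elements the carriers are formed.
\<close>

definition finitely_axiomatizable :: "('a set \<Rightarrow> 'a rel \<Rightarrow> bool) \<Rightarrow> bool" where
  "finitely_axiomatizable K \<longleftrightarrow>
    (\<exists>\<Sigma>. finite \<Sigma> \<and> (\<forall>\<phi>\<in>\<Sigma>. sentence \<phi>) \<and>
      (\<forall>A r. fo_structure A r \<longrightarrow> ((\<forall>\<phi>\<in>\<Sigma>. models A r \<phi>) \<longleftrightarrow> K A r)))"

section \<open>Representable posets\<close>

definition is_meet :: "'a set \<Rightarrow> 'a rel \<Rightarrow> 'a set \<Rightarrow> 'a \<Rightarrow> bool" where
  "is_meet A r S x \<longleftrightarrow> x \<in> A \<and> (\<forall>s\<in>S. (x, s) \<in> r) \<and>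
    (\<forall>y\<in>A. (\<forall>s\<in>S. (y, s) \<in> r) \<longrightarrow> (y, x) \<in> r)"

definition is_join :: "'a set \<Rightarrow> 'a rel \<Rightarrow> 'a set \<Rightarrow> 'a \<Rightarrow> bool" where
  "is_join A r T x \<longleftrightarrow> x \<in> A \<and> (\<forall>t\<in>T. (t, x) \<in> r) \<and>
    (\<forall>y\<in>A. (\<forall>t\<in>T. (t, y) \<in> r) \<longrightarrow> (x, y) \<in> r)"

text \<open>
  Cardinals are cardinal orders in the sense of \<open>Card_order\<close>. Fields of sets are given by the
  locale predicate \<open>algebra\<close>. Intersecting with \<open>X\<close> makes the intersection of the empty
  family equal to \<open>X\<close> (and changes nothing otherwise).
\<close>

definition poset_representation ::
    "'b rel \<Rightarrow> 'c rel \<Rightarrow> 'a set \<Rightarrow> 'a rel \<Rightarrow> 'x set \<Rightarrow> 'x set set \<Rightarrow> ('a \<Rightarrow> 'x set) \<Rightarrow> bool" where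
  "poset_representation \<alpha> \<beta> A r X F h \<longleftrightarrow>
    algebra X F \<and> h ` A \<subseteq> F \<and> inj_on h A \<and>
    (\<forall>S x. S \<subseteq> A \<and> |S| <o \<alpha> \<and> is_meet A r S x \<longrightarrow> h x = X \<inter> \<Inter>(h ` S)) \<and>
    (\<forall>T x. T \<subseteq> A \<and> |T| <o \<beta> \<and> is_join A r T x \<longrightarrow> h x = \<Union>(h ` T))"

text \<open>
  The base set of the representation is taken among the sets of subsets of the poset. This is no
  restriction: see \<open>representableI\<close> below.
\<close>

definition representable :: "'b rel \<Rightarrow> 'c rel \<Rightarrow> 'a set \<Rightarrow> 'a rel \<Rightarrow> bool" where
  "representable \<alpha> \<beta> A r \<longleftrightarrow>
    (\<exists>(X :: 'a set set) F h. poset_representation \<alpha> \<beta> A r X F h)"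

lemma representableI:
  fixes X :: "'x set" and A :: "'a set"
  assumes "poset_representation \<alpha> \<beta> A r X F h"
  shows "representable \<alpha> \<beta> A r"
proof -
  interpret algebra X F
    using assms by (simp add: poset_representation_def)
  have sub: "h p \<subseteq> X" if "p \<in> A" for p
    using assms that sets_into_space by (auto simp: poset_representation_def)
  have inj: "inj_on h A"
    using assms by (simp add: poset_representation_def)
  have meet: "h x = X \<inter> \<Inter>(h ` S)" if "S \<subseteq> A" "|S| <o \<alpha>" "is_meet A r S x" for S x
    using assms that by (simp add: poset_representation_def)
  have join: "h x = \<Union>(h ` T)" if "T \<subseteq> A" "|T| <o \<beta>" "is_join A r T x" for T x
    using assms that by (simp add: poset_representation_def)
  define u where "u = (\<lambda>x. {p \<in> A. x \<in> h p})"
  define h' where "h' = (\<lambda>p. u ` h p)"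
  have mem: "u x \<in> h' p \<longleftrightarrow> x \<in> h p" if "x \<in> X" "p \<in> A" for x p
    using that by (auto simp: h'_def u_def)
  have h'_sub: "h' p \<subseteq> u ` X" if "p \<in> A" for p
    using sub[OF that] by (auto simp: h'_def)
  have "poset_representation \<alpha> \<beta> A r (u ` X) (Pow (u ` X)) h'"
    unfolding poset_representation_def
  proof (intro conjI allI impI)
    show "algebra (u ` X) (Pow (u ` X))"
      by (rule algebra_Pow)
    show "h' ` A \<subseteq> Pow (u ` X)"
      using h'_sub by auto
    show "inj_on h' A"
    proof (rule inj_onI)
      fix p q assume pq: "p \<in> A" "q \<in> A" "h' p = h' q"
      have "h p = h q"
        using pq mem sub by blast
      then show "p = q"
        using inj pq by (auto dest: inj_onD)
    qed
  next
    fix S x assume *: "S \<subseteq> A \<and> |S| <o \<alpha> \<and> is_meet A r S x"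
    then have x: "x \<in> A" by (simp add: is_meet_def)
    have eq: "h x = X \<inter> \<Inter>(h ` S)" using meet * by blast
    show "h' x = u ` X \<inter> \<Inter>(h' ` S)"
    proof (rule set_eqI)
      fix w
      show "w \<in> h' x \<longleftrightarrow> w \<in> u ` X \<inter> \<Inter>(h' ` S)"
      proof (cases "w \<in> u ` X")
        case True
        then obtain y where y: "y \<in> X" "w = u y" by blast
        have "u y \<in> h' s \<longleftrightarrow> y \<in> h s" if "s \<in> S" for s
          using mem[OF y(1)] that * by blast
        then show ?thesis
          using y eq mem[OF y(1) x] by simp
      next
        case False
        then show ?thesis using h'_sub[OF x] by blast
      qed
    qed
  next
    fix T x assume "T \<subseteq> A \<and> |T| <o \<beta> \<and> is_join A r T x"
    then have "h x = \<Union>(h ` T)" using join by blast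
    then show "h' x = \<Union>(h' ` T)" by (simp add: h'_def image_UN)
  qed
  then show ?thesis
    unfolding representable_def by blast
qed

end

theory Submission
  imports Defs "HOL-Computational_Algebra.Polynomial"
begin

text \<open>
  Prime filters of a poset, i.e. upward closed sets which decide the existing finite meets and
  joins correctly, are the points of its representations. Take a chain \<open>a\<^sub>0 < \<dots> < a\<^sub>M\<close> with further
  elements \<open>b\<^sub>i\<close> below a common element \<open>q\<close> such that \<open>a\<^sub>i\<^sub>+\<^sub>1 = a\<^sub>i \<squnion> b\<^sub>i\<close>, and elements \<open>p \<le> a\<^sub>M\<close>,
  \<open>p \<le> c\<close> such that \<open>a\<^sub>0 \<sqinter> c \<le> q\<close>. A prime filter with \<open>p\<close> but without \<open>q\<close> contains \<open>a\<^sub>M\<close> and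
  \<open>c\<close>, hence by descent along the chain \<open>a\<^sub>0\<close>, hence \<open>q\<close>. So if \<open>M\<close> is a natural number, every
  representation satisfies \<open>h p \<subseteq> h q\<close>, and it cannot be injective since it must also identify
  \<open>p\<close> with \<open>p \<sqinter> q\<close>. If the chain looks like \<open>\<omega> + \<omega>\<^sup>*\<close>, the descent never reaches \<open>a\<^sub>0\<close>, and the
  prime filters do separate the points. By an Ehrenfeucht--Fraisse game, a sentence does not
  distinguish this chain from a long finite one, and neither does it distinguish the two posets.
\<close>

section \<open>Formulas and isomorphisms\<close>

primrec qdepth :: "poset_fm \<Rightarrow> nat" where
  "qdepth (Leq x y) = 0"
| "qdepth (Equal x y) = 0"
| "qdepth (Neg \<phi>) = qdepth \<phi>"
| "qdepth (Conj \<phi> \<psi>) = max (qdepth \<phi>) (qdepth \<psi>)"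
| "qdepth (Forall x \<phi>) = Suc (qdepth \<phi>)"

lemma sat_cong_free_vars:
  "(\<And>x. x \<in> free_vars \<phi> \<Longrightarrow> v x = w x) \<Longrightarrow> sat A r v \<phi> \<longleftrightarrow> sat A r w \<phi>"
proof (induction \<phi> arbitrary: v w)
  case (Forall x \<phi>)
  have "sat A r (v(x := a)) \<phi> \<longleftrightarrow> sat A r (w(x := a)) \<phi>" for a
    by (rule Forall.IH) (use Forall.prems in auto)
  then show ?case by simp
next
  case (Conj \<phi> \<psi>)
  have "sat A r v \<phi> \<longleftrightarrow> sat A r w \<phi>" "sat A r v \<psi> \<longleftrightarrow> sat A r w \<psi>"
    using Conj.prems by (auto intro!: Conj.IH)
  then show ?case by simp
next
  case (Neg \<phi>)
  have "sat A r v \<phi> \<longleftrightarrow> sat A r w \<phi>"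
    using Neg.prems by (auto intro!: Neg.IH)
  then show ?case by simp
qed auto

lemma models_sentence_iff:
  assumes "sentence \<phi>" "range v \<subseteq> A"
  shows "models A r \<phi> \<longleftrightarrow> sat A r v \<phi>"
proof -
  have "sat A r w \<phi> \<longleftrightarrow> sat A r v \<phi>" for w
    by (rule sat_cong_free_vars) (use assms(1) in \<open>simp add: sentence_def\<close>)
  then show ?thesis
    using assms(2) unfolding models_def by blast
qed

lemma sat_image:
  assumes "inj f"
  shows "sat (f ` A) (map_prod f f ` r) (f \<circ> v) \<phi> \<longleftrightarrow> sat A r v \<phi>"
proof (induction \<phi> arbitrary: v)
  case (Forall x \<phi>)
  have "sat (f ` A) (map_prod f f ` r) ((f \<circ> v)(x := f a)) \<phi> \<longleftrightarrow> sat A r (v(x := a)) \<phi>" for a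
    using Forall.IH[of "v(x := a)"] by (simp only: fun_upd_comp)
  then show ?case
    by (simp only: sat.simps ball_simps)
next
  case (Leq x y)
  have "(f a, f b) \<in> map_prod f f ` r \<longleftrightarrow> (a, b) \<in> r" for a b
    using assms by (auto dest: injD)
  then show ?case by simp
qed (simp_all add: inj_eq[OF assms])

lemma models_image:
  assumes "inj f" "sentence \<phi>" "a \<in> A"
  shows "models (f ` A) (map_prod f f ` r) \<phi> \<longleftrightarrow> models A r \<phi>"
proof -
  have "models (f ` A) (map_prod f f ` r) \<phi> \<longleftrightarrow> sat (f ` A) (map_prod f f ` r) (f \<circ> (\<lambda>_. a)) \<phi>"
    by (rule models_sentence_iff) (use assms in auto)
  also have "\<dots> \<longleftrightarrow> sat A r (\<lambda>_. a) \<phi>"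
    using assms sat_image by blast
  also have "\<dots> \<longleftrightarrow> models A r \<phi>"
    by (rule models_sentence_iff[symmetric]) (use assms in auto)
  finally show ?thesis .
qed

section \<open>Transport of meets, joins and representations along injections\<close>

lemma map_prod_image_iff:
  assumes "inj_on f A" "r \<subseteq> A \<times> A" "x \<in> A" "y \<in> A"
  shows "(f x, f y) \<in> map_prod f f ` r \<longleftrightarrow> (x, y) \<in> r"
proof
  assume "(f x, f y) \<in> map_prod f f ` r"
  then obtain x' y' where *: "(x', y') \<in> r" "f x = f x'" "f y = f y'"
    by auto
  moreover have "x' \<in> A" "y' \<in> A"
    using * assms(2) by auto
  then have "x = x'" "y = y'"
    using inj_onD[OF assms(1) *(2)] inj_onD[OF assms(1) *(3)] assms(3,4) by simp_all
  ultimately show "(x, y) \<in> r"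
    by simp
qed auto

lemma is_meet_image:
  assumes "inj_on f A" "r \<subseteq> A \<times> A" "S \<subseteq> A" "is_meet A r S x"
  shows "is_meet (f ` A) (map_prod f f ` r) (f ` S) (f x)"
proof -
  have x: "x \<in> A" "\<And>s. s \<in> S \<Longrightarrow> (x, s) \<in> r"
    "\<And>y. y \<in> A \<Longrightarrow> \<forall>s\<in>S. (y, s) \<in> r \<Longrightarrow> (y, x) \<in> r"
    using assms(4) by (simp_all add: is_meet_def)
  note iff = map_prod_image_iff[OF assms(1,2)]
  have "(f y, f x) \<in> map_prod f f ` r"
    if y: "y \<in> A" and low: "\<forall>s\<in>S. (f y, f s) \<in> map_prod f f ` r" for y
  proof -
    have "\<forall>s\<in>S. (y, s) \<in> r"
    proof
      fix s assume "s \<in> S"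
      then show "(y, s) \<in> r"
        using iff[of y s] y low assms(3) by auto
    qed
    then show ?thesis
      using x(3)[OF y] iff[of y x] y x(1) by simp
  qed
  then show ?thesis
    using x(1,2) unfolding is_meet_def by auto
qed

lemma is_join_image:
  assumes "inj_on f A" "r \<subseteq> A \<times> A" "T \<subseteq> A" "is_join A r T x"
  shows "is_join (f ` A) (map_prod f f ` r) (f ` T) (f x)"
proof -
  have x: "x \<in> A" "\<And>t. t \<in> T \<Longrightarrow> (t, x) \<in> r"
    "\<And>y. y \<in> A \<Longrightarrow> \<forall>t\<in>T. (t, y) \<in> r \<Longrightarrow> (x, y) \<in> r"
    using assms(4) by (simp_all add: is_join_def)
  note iff = map_prod_image_iff[OF assms(1,2)]
  have "(f x, f y) \<in> map_prod f f ` r"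
    if y: "y \<in> A" and low: "\<forall>t\<in>T. (f t, f y) \<in> map_prod f f ` r" for y
  proof -
    have "\<forall>t\<in>T. (t, y) \<in> r"
    proof
      fix t assume "t \<in> T"
      then show "(t, y) \<in> r"
        using iff[of t y] y low assms(3) by auto
    qed
    then show ?thesis
      using x(3)[OF y] iff[of x y] y x(1) by simp
  qed
  then show ?thesis
    using x(1,2) unfolding is_join_def by auto
qed

lemma poset_representationD:
  assumes "poset_representation \<alpha> \<beta> A r X F h"
  shows "algebra X F" "h ` A \<subseteq> F" "inj_on h A"
    and "\<And>S x. S \<subseteq> A \<Longrightarrow> |S| <o \<alpha> \<Longrightarrow> is_meet A r S x \<Longrightarrow> h x = X \<inter> \<Inter>(h ` S)"
    and "\<And>T x. T \<subseteq> A \<Longrightarrow> |T| <o \<beta> \<Longrightarrow> is_join A r T x \<Longrightarrow> h x = \<Union>(h ` T)"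
  using assms by (simp_all add: poset_representation_def)

lemma poset_representation_pullback:
  assumes f: "inj_on f A" "r \<subseteq> A \<times> A"
    and h: "poset_representation \<alpha> \<beta> (f ` A) (map_prod f f ` r) X F h"
  shows "poset_representation \<alpha> \<beta> A r X F (h \<circ> f)"
proof -
  note h' = poset_representationD[OF h]
  have "h (f x) = X \<inter> \<Inter>(h ` f ` S)" if "S \<subseteq> A" "|S| <o \<alpha>" "is_meet A r S x" for S x
    by (rule h'(4)[OF image_mono[OF that(1)] ordLeq_ordLess_trans[OF card_of_image that(2)]
          is_meet_image[OF f that(1,3)]])
  moreover have "h (f x) = \<Union>(h ` f ` T)" if "T \<subseteq> A" "|T| <o \<beta>" "is_join A r T x" for T x
    by (rule h'(5)[OF image_mono[OF that(1)] ordLeq_ordLess_trans[OF card_of_image that(2)]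
          is_join_image[OF f that(1,3)]])
  ultimately show ?thesis
    using h'(1,2) comp_inj_on[OF f(1) h'(3)] unfolding poset_representation_def
    by (simp add: image_comp)
qed

text \<open>Both directions are pullbacks, one along \<open>f\<close> and one along
  \<open>inv_into A f\<close>. The element type changes, and \<open>representableI\<close> moves the
  base set to the matching type.\<close>

lemma representable_image_iff:
  assumes f: "inj_on f A" "r \<subseteq> A \<times> A"
  shows "representable \<alpha> \<beta> (f ` A) (map_prod f f ` r) \<longleftrightarrow> representable \<alpha> \<beta> A r"
proof
  assume "representable \<alpha> \<beta> (f ` A) (map_prod f f ` r)"
  then show "representable \<alpha> \<beta> A r"
    using poset_representation_pullback[OF f] representableI unfolding representable_def by blast
next
  assume R: "representable \<alpha> \<beta> A r"
  let ?g = "inv_into A f"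
  have A: "?g ` f ` A = A"
    using f(1) by (force simp: image_image)
  have "map_prod ?g ?g ` map_prod f f ` r = (\<lambda>x. map_prod ?g ?g (map_prod f f x)) ` r"
    by (rule image_image)
  also have "\<dots> = (\<lambda>x. x) ` r"
  proof (rule image_cong)
    fix x assume "x \<in> r"
    then have "fst x \<in> A" "snd x \<in> A"
      using f(2) by auto
    then show "map_prod ?g ?g (map_prod f f x) = x"
      using f(1) by (cases x) simp
  qed simp
  finally have r: "map_prod ?g ?g ` map_prod f f ` r = r"
    by simp
  have sub: "map_prod f f ` r \<subseteq> f ` A \<times> f ` A"
    using f(2) by auto
  have "\<exists>(X :: 'a set set) F h. poset_representation \<alpha> \<beta> (?g ` f ` A) (map_prod ?g ?g ` map_prod f f ` r) X F h"
    using R unfolding A r representable_def .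
  then show "representable \<alpha> \<beta> (f ` A) (map_prod f f ` r)"
    using poset_representation_pullback[OF inj_on_inv_into[OF subset_refl] sub] representableI by blast
qed

lemma partial_order_on_image:
  assumes f: "inj f" and r: "partial_order_on A r"
  shows "partial_order_on (f ` A) (map_prod f f ` r)"
proof -
  have r': "refl_on A r" "trans r" "antisym r" "r \<subseteq> A \<times> A"
    using r unfolding partial_order_on_def preorder_on_def by blast+
  have "antisym (map_prod f f ` r)"
  proof (rule antisymI)
    fix x y assume "(x, y) \<in> map_prod f f ` r" "(y, x) \<in> map_prod f f ` r"
    then obtain a b a' b' where "(a, b) \<in> r" "(b', a') \<in> r" "x = f a" "y = f b" "x = f a'" "y = f b'"
      by auto
    then show "x = y"
      using r'(3) f unfolding antisym_def by (metis injD)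
  qed
  moreover have "trans (map_prod f f ` r)"
  proof (rule transI)
    fix x y z assume "(x, y) \<in> map_prod f f ` r" "(y, z) \<in> map_prod f f ` r"
    then obtain a b b' c where "(a, b) \<in> r" "(b', c) \<in> r" "x = f a" "y = f b" "y = f b'" "z = f c"
      by auto
    moreover from this have "b = b'"
      using f by (metis injD)
    ultimately show "(x, z) \<in> map_prod f f ` r"
      using transD[OF r'(2)] by force
  qed
  ultimately show ?thesis
    using r' unfolding partial_order_on_def preorder_on_def refl_on_def by auto
qed

section \<open>Prime filters\<close>

text \<open>\<open>S\<close> and \<open>T\<close> may be empty: a greatest element, if there is one,
  is then in \<open>G\<close>, and a least element is not. Finite sets suffice for cardinals up to
  \<omega>.\<close>

definition prime_filter :: "'a set \<Rightarrow> 'a rel \<Rightarrow> 'a set \<Rightarrow> bool" where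
  "prime_filter A r G \<longleftrightarrow>
    (\<forall>S x. finite S \<and> S \<subseteq> A \<and> is_meet A r S x \<longrightarrow> (x \<in> G \<longleftrightarrow> S \<subseteq> G)) \<and>
    (\<forall>T x. finite T \<and> T \<subseteq> A \<and> is_join A r T x \<longrightarrow> (x \<in> G \<longleftrightarrow> T \<inter> G \<noteq> {}))"

lemma prime_filter_meet_iff:
  assumes "prime_filter A r G" "finite S" "S \<subseteq> A" "is_meet A r S x"
  shows "x \<in> G \<longleftrightarrow> S \<subseteq> G"
  using assms by (simp add: prime_filter_def)

lemma prime_filter_join_iff:
  assumes "prime_filter A r G" "finite T" "T \<subseteq> A" "is_join A r T x"
  shows "x \<in> G \<longleftrightarrow> T \<inter> G \<noteq> {}"
  using assms by (simp add: prime_filter_def)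

lemma prime_filterI:
  assumes up: "\<And>x y. x \<in> G \<Longrightarrow> (x, y) \<in> r \<Longrightarrow> y \<in> G"
    and meet: "\<And>S x. finite S \<Longrightarrow> S \<subseteq> A \<Longrightarrow> is_meet A r S x \<Longrightarrow> S \<subseteq> G \<Longrightarrow> x \<in> G"
    and join: "\<And>T x. finite T \<Longrightarrow> T \<subseteq> A \<Longrightarrow> is_join A r T x \<Longrightarrow> x \<in> G \<Longrightarrow> T \<inter> G \<noteq> {}"
  shows "prime_filter A r G"
  unfolding prime_filter_def
proof (intro conjI allI impI; elim conjE)
  fix S x assume "finite S" "S \<subseteq> A" "is_meet A r S x"
  then show "x \<in> G \<longleftrightarrow> S \<subseteq> G"
    using meet up unfolding is_meet_def by blast
next
  fix T x assume "finite T" "T \<subseteq> A" "is_join A r T x"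
  then show "x \<in> G \<longleftrightarrow> T \<inter> G \<noteq> {}"
    using join up unfolding is_join_def by blast
qed

lemma finite_if_card_of_less:
  assumes "|S| <o \<alpha>" "\<alpha> \<le>o natLeq"
  shows "finite S"
  using assms finite_iff_ordLess_natLeq ordLess_ordLeq_trans by blast

text \<open>The points are the prime filters, and \<open>x\<close> is sent to those containing it.
  Preservation of meets and joins is the definition of a prime filter read pointwise; separation and
  antisymmetry give injectivity.\<close>

lemma representable_if_prime_filters_separate:
  fixes \<alpha> :: "'b rel" and \<beta> :: "'c rel"
  assumes po: "partial_order_on A r" and ab: "\<alpha> \<le>o natLeq" "\<beta> \<le>o natLeq"
    and sep: "\<And>x y. x \<in> A \<Longrightarrow> y \<in> A \<Longrightarrow> (x, y) \<notin> r \<Longrightarrow> \<exists>G. prime_filter A r G \<and> x \<in> G \<and> y \<notin> G"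
  shows "representable \<alpha> \<beta> A r"
proof -
  let ?X = "Collect (prime_filter A r)"
  let ?h = "\<lambda>x. {G. prime_filter A r G \<and> x \<in> G}"
  have "poset_representation \<alpha> \<beta> A r ?X (Pow ?X) ?h"
    unfolding poset_representation_def
  proof (intro conjI allI impI; (elim conjE)?)
    show "inj_on ?h A"
    proof (rule inj_onI, rule ccontr)
      fix x y assume *: "x \<in> A" "y \<in> A" "?h x = ?h y" "x \<noteq> y"
      then have "(x, y) \<notin> r \<or> (y, x) \<notin> r"
        using po unfolding partial_order_on_def antisym_def by blast
      then show False
        using sep * by blast
    qed
  next
    fix S x assume S: "S \<subseteq> A" "|S| <o \<alpha>" "is_meet A r S x"
    have "x \<in> G \<longleftrightarrow> S \<subseteq> G" if "prime_filter A r G" for G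
      by (rule prime_filter_meet_iff[OF that finite_if_card_of_less[OF S(2) ab(1)] S(1,3)])
    then show "?h x = ?X \<inter> \<Inter>(?h ` S)"
      by auto
  next
    fix T x assume T: "T \<subseteq> A" "|T| <o \<beta>" "is_join A r T x"
    have "x \<in> G \<longleftrightarrow> T \<inter> G \<noteq> {}" if "prime_filter A r G" for G
      by (rule prime_filter_join_iff[OF that finite_if_card_of_less[OF T(2) ab(2)] T(1,3)])
    then show "?h x = \<Union>(?h ` T)"
      by auto
  qed (auto intro: algebra_Pow)
  then show ?thesis
    by (rule representableI)
qed

section \<open>The posets\<close>

datatype kind = Chain | Atom | Coatom | Source | Root | Cap | Base | Target

text \<open>
  In the notation above, \<open>Chain\<close> elements are the \<open>a\<^sub>i\<close>, \<open>Atom\<close> elements the \<open>b\<^sub>i\<close>, and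
  \<open>Source\<close>, \<open>Target\<close>, \<open>Cap\<close>, \<open>Root\<close>, \<open>Base\<close> are \<open>p\<close>, \<open>q\<close>, \<open>c\<close>, \<open>p \<sqinter> q\<close>, \<open>a\<^sub>0 \<sqinter> c\<close>, which occur once, with
  dummy index 0. The \<open>Coatom\<close> of index \<open>i\<close> lies above \<open>a\<^sub>i\<close> and all \<open>b\<^sub>k\<close> with \<open>k \<noteq> i\<close>: it prevents
  unwanted joins like \<open>a\<^sub>i\<^sub>-\<^sub>1 \<squnion> b\<^sub>i = a\<^sub>i\<^sub>+\<^sub>1\<close>, which would shorten the descent.
\<close>

definition elems :: "'g::linordered_idom \<Rightarrow> (kind \<times> 'g) set" where
  "elems M = {(k, i). case k of Chain \<Rightarrow> 0 \<le> i \<and> i \<le> M | Atom \<Rightarrow> 0 \<le> i \<and> i < M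
     | Coatom \<Rightarrow> 0 \<le> i \<and> i < M | _ \<Rightarrow> i = 0}"

text \<open>The strict bound for \<open>Atom\<close> below \<open>Chain\<close> makes
  \<open>b_i\<close> the element gained between \<open>a_i\<close> and \<open>a_(i+1)\<close>.
  Indices from an ordered ring let \<open>M\<close> be a natural number or infinitely large.\<close>

definition leq :: "'g::linordered_idom \<Rightarrow> kind \<times> 'g \<Rightarrow> kind \<times> 'g \<Rightarrow> bool" where
  "leq M = (\<lambda>(k, i) (l, j). case k of
      Chain \<Rightarrow> l \<in> {Chain, Coatom} \<and> i \<le> j
    | Atom \<Rightarrow> (l = Atom \<and> i = j) \<or> (l = Chain \<and> i < j) \<or> (l = Coatom \<and> i \<noteq> j) \<or> l \<in> {Cap, Target}
    | Coatom \<Rightarrow> l = Coatom \<and> i = j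
    | Source \<Rightarrow> (l = Chain \<and> j = M) \<or> l \<in> {Source, Coatom, Cap}
    | Root \<Rightarrow> (l = Chain \<and> j = M) \<or> l \<in> {Root, Source, Coatom, Cap, Target}
    | Cap \<Rightarrow> l = Cap
    | Base \<Rightarrow> l \<in> {Base, Chain, Coatom, Cap, Target}
    | Target \<Rightarrow> l = Target)"

definition poset_rel :: "'g::linordered_idom \<Rightarrow> (kind \<times> 'g) rel" where
  "poset_rel M = {(x, y). x \<in> elems M \<and> y \<in> elems M \<and> leq M x y}"

lemma elems_simps [simp]:
  "(Chain, i) \<in> elems M \<longleftrightarrow> 0 \<le> i \<and> i \<le> M"
  "(Atom, i) \<in> elems M \<longleftrightarrow> 0 \<le> i \<and> i < M"
  "(Coatom, i) \<in> elems M \<longleftrightarrow> 0 \<le> i \<and> i < M"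
  "(Source, i) \<in> elems M \<longleftrightarrow> i = 0"
  "(Root, i) \<in> elems M \<longleftrightarrow> i = 0"
  "(Cap, i) \<in> elems M \<longleftrightarrow> i = 0"
  "(Base, i) \<in> elems M \<longleftrightarrow> i = 0"
  "(Target, i) \<in> elems M \<longleftrightarrow> i = 0"
  by (auto simp: elems_def)

lemma leq_simps [simp]:
  "leq M (Chain, i) (l, j) \<longleftrightarrow> l \<in> {Chain, Coatom} \<and> i \<le> j"
  "leq M (Atom, i) (l, j) \<longleftrightarrow>
    (l = Atom \<and> i = j) \<or> (l = Chain \<and> i < j) \<or> (l = Coatom \<and> i \<noteq> j) \<or> l \<in> {Cap, Target}"
  "leq M (Coatom, i) (l, j) \<longleftrightarrow> l = Coatom \<and> i = j"
  "leq M (Source, i) (l, j) \<longleftrightarrow> (l = Chain \<and> j = M) \<or> l \<in> {Source, Coatom, Cap}"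
  "leq M (Root, i) (l, j) \<longleftrightarrow> (l = Chain \<and> j = M) \<or> l \<in> {Root, Source, Coatom, Cap, Target}"
  "leq M (Cap, i) (l, j) \<longleftrightarrow> l = Cap"
  "leq M (Base, i) (l, j) \<longleftrightarrow> l \<in> {Base, Chain, Coatom, Cap, Target}"
  "leq M (Target, i) (l, j) \<longleftrightarrow> l = Target"
  by (simp_all add: leq_def)

lemma kind_pair_cases [case_names Chain Atom Coatom Source Root Cap Base Target]:
  obtains i where "x = (Chain, i)" | i where "x = (Atom, i)" | i where "x = (Coatom, i)"
  | i where "x = (Source, i)" | i where "x = (Root, i)" | i where "x = (Cap, i)"
  | i where "x = (Base, i)" | i where "x = (Target, i)"
  by (cases x; cases "fst x") auto

section \<open>The partial order laws and concrete forms of meets and joins\<close>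

lemma leq_refl: "leq M x x"
  by (cases x rule: kind_pair_cases) auto

lemma leq_trans:
  assumes "leq M x y" "leq M y z" "x \<in> elems M" "y \<in> elems M" "z \<in> elems M"
  shows "leq M x z"
  using assms
  by (cases x rule: kind_pair_cases; cases y rule: kind_pair_cases; simp;
      cases z rule: kind_pair_cases; simp; force)

lemma leq_antisym:
  assumes "leq M x y" "leq M y x" "x \<in> elems M" "y \<in> elems M"
  shows "x = y"
  using assms by (cases x rule: kind_pair_cases; cases y rule: kind_pair_cases; simp)

lemma poset_rel_subset: "poset_rel M \<subseteq> elems M \<times> elems M"
  by (auto simp: poset_rel_def)

lemma partial_order_poset_rel: "partial_order_on (elems M) (poset_rel M)"
  unfolding partial_order_on_def preorder_on_def
proof (intro conjI)
  show "trans (poset_rel M)"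
  proof (rule transI)
    fix x y z assume "(x, y) \<in> poset_rel M" "(y, z) \<in> poset_rel M"
    then show "(x, z) \<in> poset_rel M"
      using leq_trans[of M x y z] by (simp add: poset_rel_def)
  qed
  show "antisym (poset_rel M)"
  proof (rule antisymI)
    fix x y assume "(x, y) \<in> poset_rel M" "(y, x) \<in> poset_rel M"
    then show "x = y"
      using leq_antisym[of M x y] by (simp add: poset_rel_def)
  qed
qed (auto simp: refl_on_def poset_rel_def leq_refl)

lemma is_meet_poset_rel_iff:
  assumes "S \<subseteq> elems M"
  shows "is_meet (elems M) (poset_rel M) S x \<longleftrightarrow> x \<in> elems M \<and> (\<forall>s\<in>S. leq M x s) \<and>
    (\<forall>y\<in>elems M. (\<forall>s\<in>S. leq M y s) \<longrightarrow> leq M y x)"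
  using assms by (auto simp: is_meet_def poset_rel_def subset_iff)

lemma is_join_poset_rel_iff:
  assumes "S \<subseteq> elems M"
  shows "is_join (elems M) (poset_rel M) S x \<longleftrightarrow> x \<in> elems M \<and> (\<forall>s\<in>S. leq M s x) \<and>
    (\<forall>y\<in>elems M. (\<forall>s\<in>S. leq M s y) \<longrightarrow> leq M x y)"
  using assms by (auto simp: is_join_def poset_rel_def subset_iff)

subsection \<open>Finite length\<close>

text \<open>The lower bound 3 on the cardinals enters here: it brings binary meets and joins under
  the conditions on a representation.\<close>

lemma card_of_doubleton_less:
  assumes "|{..<3::nat}| \<le>o \<alpha>"
  shows "|{x, y :: 'a}| <o \<alpha>"
proof -
  have "\<not> (\<exists>f. inj_on f {..<3::nat} \<and> f ` {..<3} \<subseteq> {x, y})"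
  proof
    assume "\<exists>f. inj_on f {..<3::nat} \<and> f ` {..<3} \<subseteq> {x, y}"
    then have "card {..<3::nat} \<le> card {x, y}"
      using card_inj_on_le[of _ "{..<3::nat}" "{x, y}"] by blast
    also have "\<dots> \<le> 2"
      by (simp add: card_insert_if)
    finally show False by simp
  qed
  then have "|{x, y}| <o |{..<3::nat}|"
    by (simp only: card_of_ordLess)
  then show ?thesis
    using assms ordLess_ordLeq_trans by blast
qed

lemma not_representable_of_nat:
  fixes \<alpha> :: "'b rel" and \<beta> :: "'c rel" and N :: nat
  assumes discrete: "\<And>g :: 'g::linordered_idom. 0 < g \<Longrightarrow> 1 \<le> g"
    and N: "0 < N" and ab: "|{..<3::nat}| \<le>o \<alpha>" "|{..<3::nat}| \<le>o \<beta>"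
  shows "\<not> representable \<alpha> \<beta> (elems (of_nat N :: 'g)) (poset_rel (of_nat N))"
proof
  let ?M = "of_nat N :: 'g"
  assume "representable \<alpha> \<beta> (elems ?M) (poset_rel ?M)"
  then obtain X :: "(kind \<times> 'g) set set" and F h
    where R: "poset_representation \<alpha> \<beta> (elems ?M) (poset_rel ?M) X F h"
    unfolding representable_def by blast
  note R' = poset_representationD[OF R]
  interpret algebra X F by (rule R'(1))
  have sub: "h x \<subseteq> X" if "x \<in> elems ?M" for x
    using sets_into_space R'(2) that by blast
  have meet: "h z = h x \<inter> h y"
    if "x \<in> elems ?M" "y \<in> elems ?M" "is_meet (elems ?M) (poset_rel ?M) {x, y} z" for x y z
  proof -
    have "h z = X \<inter> \<Inter>(h ` {x, y})"
      by (rule R'(4)[OF _ card_of_doubleton_less[OF ab(1)] that(3)]) (use that in simp)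
    then show ?thesis
      using sub[OF that(1)] by auto
  qed
  have join: "h z = h x \<union> h y"
    if "x \<in> elems ?M" "y \<in> elems ?M" "is_join (elems ?M) (poset_rel ?M) {x, y} z" for x y z
  proof -
    have "h z = \<Union>(h ` {x, y})"
      by (rule R'(5)[OF _ card_of_doubleton_less[OF ab(2)] that(3)]) (use that in simp)
    then show ?thesis
      by auto
  qed
  \<comment> \<open>Monotonicity comes from \<open>y\<close> being the join of \<open>x\<close> and
    \<open>y\<close>.\<close>
  have mono: "h x \<subseteq> h y" if "x \<in> elems ?M" "y \<in> elems ?M" "leq ?M x y" for x y
  proof -
    have "is_join (elems ?M) (poset_rel ?M) {x, y} y"
      using that by (subst is_join_poset_rel_iff) (auto simp: leq_refl)
    then show ?thesis
      using join that by blast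
  qed
  have step: "h (Chain, of_nat (Suc j)) \<subseteq> h (Chain, of_nat j) \<union> h (Target, 0)" if "j < N" for j
  proof -
    have less: "(of_nat j :: 'g) + 1 \<le> i" if "of_nat j < i" for i :: 'g
      using discrete[of "i - of_nat j"] that by (simp add: algebra_simps)
    have j: "(of_nat j :: 'g) < ?M" "(of_nat j :: 'g) + 1 \<le> ?M"
      using that less of_nat_less_iff by blast+
    \<comment> \<open>The common upper bounds are chain elements and coatoms of index above
      \<open>j\<close>, since neither of those of index \<open>j\<close> is above the atom of index
      \<open>j\<close>. By \<open>less\<close> their index is at least \<open>j + 1\<close>.\<close>
    have "is_join (elems ?M) (poset_rel ?M) {(Chain, of_nat j), (Atom, of_nat j)} (Chain, of_nat (Suc j))"
    proof (subst is_join_poset_rel_iff)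
      have "leq ?M (Chain, of_nat (Suc j)) y"
        if "y \<in> elems ?M" "leq ?M (Chain, of_nat j) y" "leq ?M (Atom, of_nat j) y" for y
        using that less by (cases y rule: kind_pair_cases) (simp_all add: add.commute)
      then show "(Chain, of_nat (Suc j)) \<in> elems ?M \<and>
        (\<forall>s\<in>{(Chain, of_nat j), (Atom, of_nat j)}. leq ?M s (Chain, of_nat (Suc j))) \<and>
        (\<forall>y\<in>elems ?M. (\<forall>s\<in>{(Chain, of_nat j), (Atom, of_nat j)}. leq ?M s y) \<longrightarrow>
          leq ?M (Chain, of_nat (Suc j)) y)"
        using j by (auto simp: add.commute)
    qed (use j in auto)
    then have "h (Chain, of_nat (Suc j)) = h (Chain, of_nat j) \<union> h (Atom, of_nat j)"
      using j by (intro join) auto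
    moreover have "h (Atom, of_nat j) \<subseteq> h (Target, 0)"
      using j by (intro mono) auto
    ultimately show ?thesis
      by blast
  qed
  have chain: "h (Chain, of_nat j) \<subseteq> h (Chain, 0) \<union> h (Target, 0)" if "j \<le> N" for j
    using that
  proof (induction j)
    case (Suc j)
    then show ?case
      using step[of j] by auto
  qed auto
  have "is_meet (elems ?M) (poset_rel ?M) {(Chain, 0), (Cap, 0)} (Base, 0)"
  proof (subst is_meet_poset_rel_iff)
    \<comment> \<open>\<open>0 < N\<close> keeps \<open>Source\<close> and \<open>Root\<close>,
      which lie below the top of the chain, from lying below \<open>(Chain, 0)\<close>.\<close>
    have "leq ?M y (Base, 0)"
      if "y \<in> elems ?M" "leq ?M y (Chain, 0)" "leq ?M y (Cap, 0)" for y
      using that N by (cases y rule: kind_pair_cases) simp_all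
    then show "(Base, 0) \<in> elems ?M \<and> (\<forall>s\<in>{(Chain, 0), (Cap, 0)}. leq ?M (Base, 0) s) \<and>
        (\<forall>y\<in>elems ?M. (\<forall>s\<in>{(Chain, 0), (Cap, 0)}. leq ?M y s) \<longrightarrow> leq ?M y (Base, 0))"
      by auto
  qed auto
  then have "h (Chain, 0) \<inter> h (Cap, 0) = h (Base, 0)"
    using meet[of "(Chain, 0)" "(Cap, 0)" "(Base, 0)"] by simp
  also have "\<dots> \<subseteq> h (Target, 0)"
    by (rule mono) auto
  finally have "h (Chain, 0) \<inter> h (Cap, 0) \<subseteq> h (Target, 0)" .
  moreover have "h (Source, 0) \<subseteq> h (Chain, ?M) \<inter> h (Cap, 0)"
    by (intro Int_greatest mono) auto
  moreover have "h (Source, 0) \<inter> h (Target, 0) = h (Root, 0)"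
  proof -
    have "leq ?M y (Root, 0)"
      if "y \<in> elems ?M" "leq ?M y (Source, 0)" "leq ?M y (Target, 0)" for y
      using that by (cases y rule: kind_pair_cases) simp_all
    then have "is_meet (elems ?M) (poset_rel ?M) {(Source, 0), (Target, 0)} (Root, 0)"
      by (subst is_meet_poset_rel_iff) auto
    then show ?thesis
      using meet[of "(Source, 0)" "(Target, 0)" "(Root, 0)"] by simp
  qed
  ultimately have "h (Source, 0) = h (Root, 0)"
    using chain[of N] by blast
  then show False
    using inj_onD[OF R'(3), of "(Source, 0)" "(Root, 0)"] by simp
qed

subsection \<open>Infinite length\<close>

text \<open>Any other \<open>x\<close> is refuted by an upper bound of \<open>T\<close> that is not
  above \<open>x\<close>. With \<open>l\<close> the greatest chain index in \<open>T\<close> and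
  \<open>l \<le> k < i\<close>, the coatom of index \<open>k\<close> is such a bound unless
  \<open>T\<close> contains the atom of index \<open>k\<close>.\<close>

lemma is_join_elems_cases:
  assumes T: "finite T" "T \<subseteq> elems M" and join: "is_join (elems M) (poset_rel M) T x" "x \<notin> T"
    and M: "0 < M"
  obtains i l where "x = (Chain, i)" "l < i" "(Chain, l) \<in> T" "\<And>k. l \<le> k \<Longrightarrow> k < i \<Longrightarrow> (Atom, k) \<in> T"
proof -
  have x: "x \<in> elems M" and ub: "\<And>s. s \<in> T \<Longrightarrow> leq M s x"
    and least: "\<And>y. y \<in> elems M \<Longrightarrow> (\<And>s. s \<in> T \<Longrightarrow> leq M s y) \<Longrightarrow> leq M x y"
    using join(1) T(2) by (simp_all add: is_join_poset_rel_iff)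
  have T_cases: "s \<in> elems M" "leq M s x" "s \<noteq> x" if "s \<in> T" for s
    using that T(2) ub join(2) by auto
  have "leq M x (Chain, M)" if "fst x \<in> {Coatom, Cap, Target}"
  proof (rule least)
    fix s assume "s \<in> T"
    from T_cases[OF this] that x M show "leq M s (Chain, M)"
      by (cases x rule: kind_pair_cases; cases s rule: kind_pair_cases; simp)
  qed (use M in simp)
  \<comment> \<open>These elements are minimal, so \<open>T\<close> would be empty and
    \<open>x\<close> a least element; but \<open>Base\<close> and \<open>Root\<close> have no common
    lower bound.\<close>
  moreover have False if "fst x \<in> {Atom, Base, Root}"
  proof -
    have T0: "s \<notin> T" for s
      using T_cases[of s] that x by (cases x rule: kind_pair_cases; cases s rule: kind_pair_cases; auto)
    have "leq M x (Base, 0)" "leq M x (Root, 0)"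
      by (rule least; use T0 in simp)+
    then show False
      using that by (cases x rule: kind_pair_cases) simp_all
  qed
  moreover have "leq M x (Root, 0)" if "fst x = Source"
  proof (rule least)
    fix s assume "s \<in> T"
    from T_cases[OF this] that x show "leq M s (Root, 0)"
      by (cases x rule: kind_pair_cases; cases s rule: kind_pair_cases; simp)
  qed simp
  ultimately obtain i where i: "x = (Chain, i)"
    by (cases x rule: kind_pair_cases) auto
  have "\<exists>l. (Chain, l) \<in> T"
  proof (rule ccontr)
    assume no: "\<nexists>l. (Chain, l) \<in> T"
    have "leq M x (Cap, 0)"
    proof (rule least)
      fix s assume s: "s \<in> T"
      with T_cases[OF s] no i show "leq M s (Cap, 0)"
        by (cases s rule: kind_pair_cases) auto
    qed simp
    then show False
      using i by simp
  qed
  moreover have fin: "finite {l. (Chain, l) \<in> T}"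
    using finite_vimageI[OF T(1), of "Pair Chain"] by (simp add: inj_def vimage_def)
  moreover define l where "l = Max {l. (Chain, l) \<in> T}"
  ultimately have l: "(Chain, l) \<in> T" "\<And>l'. (Chain, l') \<in> T \<Longrightarrow> l' \<le> l"
    using Max_in[OF fin] Max_ge[OF fin] by auto
  have "l < i" "0 \<le> l" "i \<le> M"
    using T_cases[OF l(1)] x i by auto
  have "(Atom, k) \<in> T" if "l \<le> k" "k < i" for k
  proof (rule ccontr)
    assume no: "(Atom, k) \<notin> T"
    have "leq M x (Coatom, k)"
    proof (rule least)
      show "(Coatom, k) \<in> elems M"
        using that \<open>0 \<le> l\<close> \<open>i \<le> M\<close> by simp
      fix s assume s: "s \<in> T"
      show "leq M s (Coatom, k)"
      proof (cases s rule: kind_pair_cases)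
        case (Chain l')
        then show ?thesis
          using l(2)[of l'] s that by simp
      next
        case (Atom j)
        then show ?thesis
          using s no by auto
      qed (use T_cases[OF s] i in auto)
    qed
    then show False
      using i that by simp
  qed
  then show thesis
    using that i \<open>l < i\<close> l(1) by blast
qed

text \<open>Other cases are refuted by lower bounds of \<open>S\<close> not below \<open>x\<close>.
  If \<open>Source\<close> is not in \<open>S\<close>, the main one is the atom of index
  \<open>k\<close>: only the coatom of index \<open>k\<close> or a chain element of index at most
  \<open>k\<close> in \<open>S\<close> can prevent it from being a lower bound.\<close>

lemma is_meet_elems_cases:
  assumes S: "finite S" "S \<subseteq> elems M" and meet: "is_meet (elems M) (poset_rel M) S x" "x \<notin> S"
    and M: "infinite {0..<M}"
  obtains (Root) "x = (Root, 0)" "(Source, 0) \<in> S" "(Target, 0) \<in> S"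
  | (Chain) m i where "x = (Chain, m)" "m < i" "i < M" "(Chain, i) \<in> S"
      "\<And>k. m \<le> k \<Longrightarrow> k < i \<Longrightarrow> (Coatom, k) \<in> S"
  | (Base) i where "x = (Base, 0)" "(Chain, i) \<in> S" "\<And>k. 0 \<le> k \<Longrightarrow> k < i \<Longrightarrow> (Coatom, k) \<in> S"
      "(Cap, 0) \<in> S \<or> (Target, 0) \<in> S"
proof -
  have x: "x \<in> elems M" and lb: "\<And>s. s \<in> S \<Longrightarrow> leq M x s"
    and greatest: "\<And>y. y \<in> elems M \<Longrightarrow> (\<And>s. s \<in> S \<Longrightarrow> leq M y s) \<Longrightarrow> leq M y x"
    using meet(1) S(2) by (simp_all add: is_meet_poset_rel_iff)
  have S_cases: "s \<in> elems M" "leq M x s" "s \<noteq> x" if "s \<in> S" for s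
    using that S(2) lb meet(2) by auto
  have "0 < M"
    using M by (metis atLeastLessThan_empty finite.emptyI not_less)
  show thesis
  proof (cases "(Source, 0) \<in> S")
    case True
    have x0: "x = (Root, 0)"
      using S_cases[OF True] x by (cases x rule: kind_pair_cases) auto
    have "(Target, 0) \<in> S"
    proof (rule ccontr)
      assume no: "(Target, 0) \<notin> S"
      have "leq M (Source, 0) x"
      proof (rule greatest)
        fix s assume s: "s \<in> S"
        with S_cases[OF s] no x0 show "leq M (Source, 0) s"
          by (cases s rule: kind_pair_cases) auto
      qed simp
      then show False
        using x0 by simp
    qed
    then show ?thesis
      using Root x0 True by blast
  next
    case no_source: False
    \<comment> \<open>\<open>Atom\<close>, \<open>Root\<close> and \<open>Base\<close> are minimal,
      while \<open>x\<close> lies strictly below \<open>s\<close>.\<close>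
    have kinds: "fst s \<in> {Chain, Coatom, Cap, Target}" if s: "s \<in> S" for s
      using S_cases[OF s] x no_source s
      by (cases s rule: kind_pair_cases; cases x rule: kind_pair_cases; auto)
    have atom: "leq M (Atom, k) x" if k: "0 \<le> k" "k < M" "(Coatom, k) \<notin> S"
      "\<And>i. (Chain, i) \<in> S \<Longrightarrow> k < i" for k
    proof (rule greatest)
      fix s assume s: "s \<in> S"
      with kinds[OF s] k(3,4) show "leq M (Atom, k) s"
        by (cases s rule: kind_pair_cases) auto
    qed (use k in simp)
    have base: "leq M (Base, 0) x"
    proof (rule greatest)
      fix s assume s: "s \<in> S"
      show "leq M (Base, 0) s"
        using kinds[OF s] by (cases s rule: kind_pair_cases) auto
    qed simp
    have "\<exists>i. (Chain, i) \<in> S"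
    proof (rule ccontr)
      assume no: "\<nexists>i. (Chain, i) \<in> S"
      have "finite {k. (Coatom, k) \<in> S}"
        using finite_vimageI[OF S(1), of "Pair Coatom"] by (simp add: inj_def vimage_def)
      \<comment> \<open>The finite set \<open>S\<close> misses some coatom, so both an atom and
        \<open>Base\<close> are below \<open>x\<close>.\<close>
      then obtain k where k: "k \<in> {0..<M}" "(Coatom, k) \<notin> S"
        using M finite_subset by (metis (mono_tags, lifting) mem_Collect_eq subsetI)
      then have "leq M (Atom, k) x"
        using no by (intro atom) auto
      then have kx: "fst x \<in> {Chain, Coatom, Cap, Target}"
        using base by (cases x rule: kind_pair_cases) auto
      have ne: "S \<noteq> {}"
      proof
        assume "S = {}"
        then have "leq M (Cap, 0) x" "leq M (Target, 0) x"
          by (auto intro!: greatest)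
        then show False
          by (cases x rule: kind_pair_cases) auto
      qed
      \<comment> \<open>Coatoms, \<open>Cap\<close> and \<open>Target\<close> are maximal, so
        \<open>x\<close> is a chain element and \<open>S\<close> consists of coatoms. Then
        \<open>Source\<close> is a lower bound, which puts \<open>x\<close> at index
        \<open>M\<close>, beyond every coatom index.\<close>
      have coatom: "\<exists>i j. x = (Chain, i) \<and> s = (Coatom, j) \<and> i \<le> j" if s: "s \<in> S" for s
        using S_cases[OF s] kinds[OF s] kx x no s
        by (cases x rule: kind_pair_cases; cases s rule: kind_pair_cases; auto)
      then obtain i j where ij: "x = (Chain, i)" "(Coatom, j) \<in> S" "i \<le> j"
        using ne by blast
      have "leq M (Source, 0) x"
      proof (rule greatest)
        fix s assume "s \<in> S"
        from coatom[OF this] show "leq M (Source, 0) s"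
          by auto
      qed simp
      then show False
        using ij S_cases(1)[OF ij(2)] by simp
    qed
    moreover have fin: "finite {i. (Chain, i) \<in> S}"
      using finite_vimageI[OF S(1), of "Pair Chain"] by (simp add: inj_def vimage_def)
    moreover define i where "i = Min {i. (Chain, i) \<in> S}"
    ultimately have i: "(Chain, i) \<in> S" "\<And>i'. (Chain, i') \<in> S \<Longrightarrow> i \<le> i'"
      using Min_in[OF fin] Min_le[OF fin] by auto
    have i_bounds: "0 \<le> i" "i \<le> M"
      using S_cases(1)[OF i(1)] by auto
    have atom': "leq M (Atom, k) x" if "0 \<le> k" "k < i" "(Coatom, k) \<notin> S" for k
      using that i_bounds i(2) by (intro atom) force+
    show thesis
    proof (cases "(Cap, 0) \<in> S \<or> (Target, 0) \<in> S")
      case True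
      then have x0: "x = (Base, 0)"
        using base S_cases(2)[OF i(1)] S_cases(2)[of "(Cap, 0)"] S_cases(2)[of "(Target, 0)"] x
        by (cases x rule: kind_pair_cases) auto
      have "(Coatom, k) \<in> S" if "0 \<le> k" "k < i" for k
        using atom'[OF that] x0 by auto
      then show ?thesis
        using Base x0 i(1) True by blast
    next
      case False
      have kinds': "fst s \<in> {Chain, Coatom}" if s: "s \<in> S" for s
        using kinds[OF s] S_cases(1)[OF s] False s by (cases s rule: kind_pair_cases) auto
      define K where "K = {k. (Coatom, k) \<in> S \<and> k < i}"
      have "finite {k. (Coatom, k) \<in> S}"
        using finite_vimageI[OF S(1), of "Pair Coatom"] by (simp add: inj_def vimage_def)
      then have finK: "finite K"
        by (rule rev_finite_subset) (auto simp: K_def)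
      have "K \<noteq> {}"
      proof
        assume K: "K = {}"
        have "leq M (Chain, i) x"
        proof (rule greatest)
          fix s assume s: "s \<in> S"
          with kinds'[OF s] i(2) K show "leq M (Chain, i) s"
            by (cases s rule: kind_pair_cases) (auto simp: K_def not_less)
        qed (use i_bounds in simp)
        then have "x = (Chain, i)"
          using S_cases(2)[OF i(1)] by (cases x rule: kind_pair_cases) auto
        then show False
          using i(1) meet(2) by simp
      qed
      \<comment> \<open>A coatom of index below \<open>i\<close> cuts the chain down to its own
        index, so the smallest such index is that of the meet.\<close>
      define m where "m = Min K"
      have m: "(Coatom, m) \<in> S" "m < i" "\<And>k. (Coatom, k) \<in> S \<Longrightarrow> k < i \<Longrightarrow> m \<le> k"
        using Min_in[OF finK \<open>K \<noteq> {}\<close>] Min_le[OF finK] by (auto simp: m_def K_def)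
      have "0 \<le> m"
        using S_cases(1)[OF m(1)] by simp
      have "leq M (Chain, m) x"
      proof (rule greatest)
        fix s assume s: "s \<in> S"
        show "leq M (Chain, m) s"
        proof (cases s rule: kind_pair_cases)
          case (Chain j)
          then show ?thesis
            using s i(2)[of j] m(2) by simp
        next
          case (Coatom j)
          then show ?thesis
            using s m(2) m(3)[of j] by (cases "j < i") auto
        qed (use kinds'[OF s] in auto)
      qed (use i_bounds m(2) \<open>0 \<le> m\<close> in simp)
      then have x0: "x = (Chain, m)"
        using S_cases[OF m(1)] by (cases x rule: kind_pair_cases) auto
      have "(Coatom, k) \<in> S" if "m \<le> k" "k < i" for k
        using atom'[of k] that \<open>0 \<le> m\<close> x0 by force
      \<comment> \<open>Otherwise \<open>Source\<close> would be a lower bound too. This bound later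
        admits a prime filter with \<open>(Chain, M)\<close> and all coatoms but no other chain
        element.\<close>
      moreover have "i < M"
      proof (rule ccontr)
        assume "\<not> i < M"
        have "leq M (Source, 0) x"
        proof (rule greatest)
          fix s assume s: "s \<in> S"
          show "leq M (Source, 0) s"
            using kinds'[OF s] S_cases(1)[OF s] i(2) \<open>\<not> i < M\<close> s
            by (cases s rule: kind_pair_cases) force+
        qed simp
        then show False
          using x0 m(2) i_bounds(2) by simp
      qed
      ultimately show ?thesis
        using Chain x0 m(2) i(1) by blast
    qed
  qed
qed

text \<open>The classification of meets and joins leaves these closure conditions. Their intervals
  are finite because each of their indices contributes an atom to the finite \<open>T\<close> or a
  coatom to the finite \<open>S\<close>; across an infinite interval nothing is required.\<close>

lemma prime_filter_elemsI:
  assumes M: "infinite {0..<M}" and sub: "G \<subseteq> elems M"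
    and up: "\<And>x y. x \<in> G \<Longrightarrow> y \<in> elems M \<Longrightarrow> leq M x y \<Longrightarrow> y \<in> G"
    and J: "\<And>l i. 0 \<le> l \<Longrightarrow> l < i \<Longrightarrow> finite {l..<i} \<Longrightarrow> (Chain, i) \<in> G \<Longrightarrow> (Chain, l) \<notin> G \<Longrightarrow>
      \<exists>k\<in>{l..<i}. (Atom, k) \<in> G"
    and M1: "\<And>m i. 0 \<le> m \<Longrightarrow> m < i \<Longrightarrow> i < M \<Longrightarrow> finite {m..<i} \<Longrightarrow> (Chain, i) \<in> G \<Longrightarrow>
      \<forall>k\<in>{m..<i}. (Coatom, k) \<in> G \<Longrightarrow> (Chain, m) \<in> G"
    and M2: "\<And>i. finite {0..<i} \<Longrightarrow> (Chain, i) \<in> G \<Longrightarrow> \<forall>k\<in>{0..<i}. (Coatom, k) \<in> G \<Longrightarrow>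
      (Cap, 0) \<in> G \<or> (Target, 0) \<in> G \<Longrightarrow> (Base, 0) \<in> G"
    and M3: "(Source, 0) \<in> G \<Longrightarrow> (Target, 0) \<in> G \<Longrightarrow> (Root, 0) \<in> G"
  shows "prime_filter (elems M) (poset_rel M) G"
proof (rule prime_filterI)
  fix x y assume "x \<in> G" "(x, y) \<in> poset_rel M"
  then show "y \<in> G"
    using up[of x y] by (simp add: poset_rel_def)
next
  fix S x assume S: "finite S" "S \<subseteq> elems M" "is_meet (elems M) (poset_rel M) S x" "S \<subseteq> G"
  have x: "x \<in> elems M"
    using S(3) by (simp add: is_meet_def)
  have fin: "finite {m..<i}" if "\<And>k. m \<le> k \<Longrightarrow> k < i \<Longrightarrow> (Coatom, k) \<in> S" for m i
  proof (rule finite_subset)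
    show "{m..<i} \<subseteq> Pair Coatom -` S"
      using that by auto
    show "finite (Pair Coatom -` S)"
      using S(1) by (intro finite_vimageI) (auto simp: inj_def)
  qed
  show "x \<in> G"
  proof (cases "x \<in> S")
    case False
    show ?thesis
      using S(1-3) False M
    proof (cases rule: is_meet_elems_cases)
      case Root
      then show ?thesis
        using M3 S(4) by blast
    next
      case (Chain m i)
      then have "(Chain, i) \<in> G" "\<forall>k\<in>{m..<i}. (Coatom, k) \<in> G"
        using S(4) by auto
      then show ?thesis
        using M1[of m i] fin[of m i] x Chain by simp
    next
      case (Base i)
      then have "(Chain, i) \<in> G" "\<forall>k\<in>{0..<i}. (Coatom, k) \<in> G" "(Cap, 0) \<in> G \<or> (Target, 0) \<in> G"
        using S(4) by auto
      then show ?thesis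
        using M2[of i] fin[of 0 i] Base by simp
    qed
  qed (use S(4) in blast)
next
  fix T x assume T: "finite T" "T \<subseteq> elems M" "is_join (elems M) (poset_rel M) T x" "x \<in> G"
  have M0: "0 < M"
    using M by (metis atLeastLessThan_empty finite.emptyI not_less)
  show "T \<inter> G \<noteq> {}"
  proof (cases "x \<in> T")
    case False
    from is_join_elems_cases[OF T(1-3) False M0] obtain i l
      where il: "x = (Chain, i)" "l < i" "(Chain, l) \<in> T" "\<And>k. l \<le> k \<Longrightarrow> k < i \<Longrightarrow> (Atom, k) \<in> T"
      by blast
    have "finite {l..<i}"
    proof (rule finite_subset)
      show "{l..<i} \<subseteq> Pair Atom -` T"
        using il(4) by auto
      show "finite (Pair Atom -` T)"
        using T(1) by (intro finite_vimageI) (auto simp: inj_def)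
    qed
    moreover have "0 \<le> l"
      using il(3) T(2) by auto
    ultimately have "(Chain, l) \<in> G \<or> (\<exists>k\<in>{l..<i}. (Atom, k) \<in> G)"
      using J[of l i] il(1,2) T(4) by blast
    moreover have "(Atom, k) \<in> T" if "k \<in> {l..<i}" for k
      using il(4) that by simp
    ultimately show ?thesis
      using il(3) by blast
  qed (use T(4) in blast)
qed

lemma poset_rel_separation:
  fixes M :: "'g::linordered_idom"
  assumes discrete: "\<And>g :: 'g. 0 < g \<Longrightarrow> 1 \<le> g" and M: "\<And>n. of_nat n < M"
    and xy: "x \<in> elems M" "y \<in> elems M" "\<not> leq M x y"
  shows "\<exists>G. prime_filter (elems M) (poset_rel M) G \<and> x \<in> G \<and> y \<notin> G"
proof -
  \<comment> \<open>The indices beyond all natural numbers. An interval from outside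
    \<open>U\<close> into \<open>U\<close> is infinite, as it contains all
    \<open>l + of_nat n\<close>.\<close>
  define U where "U = {i :: 'g. \<forall>n. of_nat n < i}"
  have inf: "infinite {l..<i}" if l: "0 \<le> l" "l \<notin> U" and i: "i \<in> U" for l i
  proof
    assume "finite {l..<i}"
    obtain k where k: "l \<le> of_nat k"
      using l(2) by (auto simp: U_def not_less)
    have "range (\<lambda>n. l + of_nat n) \<subseteq> {l..<i}"
    proof (rule image_subsetI)
      fix n :: nat
      have "l + of_nat n \<le> of_nat (k + n)"
        using k by simp
      also have "\<dots> < i"
        using i unfolding U_def by blast
      finally show "l + of_nat n \<in> {l..<i}"
        by simp
    qed
    then have "finite (range (\<lambda>n. l + of_nat n))"
      using \<open>finite {l..<i}\<close> finite_subset by blast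
    moreover have "inj (\<lambda>n. l + of_nat n)"
      by (auto simp: inj_def)
    ultimately show False
      using range_inj_infinite by blast
  qed
  have MU: "M \<in> U" and U0: "0 \<notin> U"
    using M by (auto simp: U_def intro!: exI[of _ 0])
  have U_up: "j \<in> U" if "i \<in> U" "i \<le> j" for i j
    using that unfolding U_def by (auto intro: less_le_trans)
  have infM: "infinite {0..<M}"
    by (rule inf[OF order_refl U0 MU])
  have M1: "0 < M" "1 < M"
    using M[of 0] M[of 1] by simp_all
  note prime = prime_filter_elemsI[OF infM]
  have maximal: "prime_filter (elems M) (poset_rel M) {x}" if "fst x \<in> {Coatom, Cap, Target}"
    by (rule prime; use that xy(1) in \<open>cases x rule: kind_pair_cases; auto\<close>)
  have chains: "prime_filter (elems M) (poset_rel M) {x \<in> elems M. fst x \<in> {Chain, Coatom}}"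
  proof (rule prime, goal_cases)
    case (2 x y)
    then show ?case
      by (cases x rule: kind_pair_cases; cases y) auto
  qed auto
  \<comment> \<open>If this principal filter contains \<open>(Chain, i)\<close> but not
    \<open>(Chain, l)\<close>, then \<open>l \<le> j < i\<close>, so its own atom is the one that a
    join requires.\<close>
  have above_atom: "prime_filter (elems M) (poset_rel M) {x \<in> elems M. leq M (Atom, j) x}"
    if j: "(Atom, j) \<in> elems M" for j
  proof (rule prime, goal_cases)
    case (2 x y)
    then show ?case
      using leq_trans[of M "(Atom, j)" x y] j by auto
  next
    case (3 l i)
    then show ?case
      using j by (intro bexI[of _ j]) auto
  next
    case (4 m i)
    then have "j \<notin> {m..<i}"
      by auto
    with 4 show ?case
      by auto
  next
    case (5 i)
    then have "j \<notin> {0..<i}"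
      by auto
    with 5 show ?case
      using j by auto
  qed auto
  have above_base: "prime_filter (elems M) (poset_rel M) {x \<in> elems M. leq M (Base, 0) x}"
  proof (rule prime, goal_cases)
    case (2 x y)
    then show ?case
      using leq_trans[of M "(Base, 0)" x y] by auto
  qed auto
  \<comment> \<open>the cut between \<open>\<omega>\<close> and \<open>\<omega>\<^sup>*\<close>, never crossed by finite meets and joins\<close>
  have upper: "prime_filter (elems M) (poset_rel M)
      {x \<in> elems M. fst x \<in> insert Coatom B \<or> fst x = Chain \<and> snd x \<in> U}"
    if B: "B = {Source, Cap} \<or> B = {Source, Root, Cap, Target}" for B
  proof (rule prime, goal_cases)
    case (2 x y)
    then show ?case
      using B MU U_up[of "snd x" "snd y"]
      by (cases x rule: kind_pair_cases; cases y rule: kind_pair_cases; auto)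
  next
    case (3 l i)
    then show ?case
      using inf[of l i] B by auto
  next
    case (4 m i)
    then show ?case
      using inf[of m i] B by auto
  next
    case (5 i)
    then show ?case
      using inf[of 0 i] U0 B by auto
  qed (use B in auto)
  \<comment> \<open>Every interval ending at \<open>M\<close> contains \<open>M - 1\<close>, so one
    atom serves all joins at \<open>(Chain, M)\<close>. The meet to \<open>(Base, 0)\<close> would
    need all of \<open>{0..<M}\<close> to be finite.\<close>
  have last: "prime_filter (elems M) (poset_rel M)
      {x \<in> elems M. fst x \<in> {Root, Source, Cap, Target, Coatom} \<or> x = (Chain, M) \<or> x = (Atom, M - 1)}"
  proof (rule prime, goal_cases)
    case (2 x y)
    have "M \<le> j" if "M - 1 < j" for j
      using discrete[of "j - (M - 1)"] that by simp
    with 2 show ?case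
      by (cases x rule: kind_pair_cases; cases y rule: kind_pair_cases; force)
  next
    case (3 l i)
    then have "i = M"
      by auto
    then have "M - 1 \<in> {l..<i}"
      using discrete[of "M - l"] 3 by (simp add: algebra_simps)
    then show ?case
      using M1 by (intro bexI[of _ "M - 1"]) auto
  next
    case (5 i)
    then have "(Coatom, 0) \<in> elems M"
      using M1 by simp
    have "i = M"
      using 5 by auto
    then show ?case
      using infM 5 by blast
  qed auto
  show ?thesis
  proof (cases x rule: kind_pair_cases)
    case (Chain i)
    show ?thesis
    proof (cases "\<exists>j. y = (Chain, j) \<or> y = (Coatom, j)")
      case True
      then obtain j where j: "y = (Chain, j) \<or> y = (Coatom, j)"
        by blast
      then have "j < i" "(Atom, j) \<in> elems M"
        using Chain xy by auto
      then show ?thesis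
        using above_atom[of j] Chain xy(1) j by (intro exI conjI) auto
    next
      case False
      then have "fst y \<notin> {Chain, Coatom}"
        by (cases y) auto
      then show ?thesis
        using chains Chain xy(1) by (intro exI conjI) auto
    qed
  next
    case (Atom j)
    then show ?thesis
      using above_atom[of j] xy by (intro exI conjI) (auto simp del: leq_simps simp: leq_refl)
  next
    case (Base i)
    then have "i = 0"
      using xy(1) by simp
    then show ?thesis
      using above_base xy Base by (intro exI conjI) (auto simp del: leq_simps simp: leq_refl)
  next
    case (Source i)
    show ?thesis
    proof (cases "\<exists>j. y = (Chain, j)")
      case True
      then show ?thesis
        using last xy Source by (intro exI conjI) auto
    next
      case False
      \<comment> \<open>For \<open>y = (Target, 0)\<close> this is the separation that fails in the
        finite posets.\<close>
      then show ?thesis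
        using upper[of "{Source, Cap}"] xy Source
        by (intro exI conjI; simp; cases y rule: kind_pair_cases; auto)
    qed
  next
    case (Root i)
    show ?thesis
    proof (cases "\<exists>j. y = (Chain, j)")
      case True
      then show ?thesis
        using last xy Root by (intro exI conjI) auto
    next
      case False
      then show ?thesis
        using upper[of "{Source, Root, Cap, Target}"] xy Root
        by (intro exI conjI; simp; cases y rule: kind_pair_cases; auto)
    qed
  qed (use maximal xy leq_refl in \<open>(intro exI[of _ "{x}"] conjI; auto)+\<close>)
qed

lemma representable_infinite:
  fixes \<alpha> :: "'b rel" and \<beta> :: "'c rel" and M :: "'g::linordered_idom"
  assumes discrete: "\<And>g :: 'g. 0 < g \<Longrightarrow> 1 \<le> g" and M: "\<And>n. of_nat n < M"
    and ab: "\<alpha> \<le>o natLeq" "\<beta> \<le>o natLeq"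
  shows "representable \<alpha> \<beta> (elems M) (poset_rel M)"
proof (rule representable_if_prime_filters_separate[OF partial_order_poset_rel ab])
  fix x y assume xy: "x \<in> elems M" "y \<in> elems M" "(x, y) \<notin> poset_rel M"
  then have not_leq: "\<not> leq M x y"
    by (simp add: poset_rel_def)
  show "\<exists>G. prime_filter (elems M) (poset_rel M) G \<and> x \<in> G \<and> y \<notin> G"
    by (rule poset_rel_separation[OF discrete M xy(1,2) not_leq])
qed

section \<open>Ehrenfeucht--Fraisse games\<close>

text \<open>The visible part of a distance: for \<open>0 \<le> t\<close>, equal clamps mean equal
  values or values on the same side at distance at least \<open>t\<close> from 0.\<close>

definition clamp :: "'g::linordered_idom \<Rightarrow> 'g \<Rightarrow> 'g" where
  "clamp t z = max (- t) (min t z)"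

text \<open>A position of the game as a set of matched pairs: distances agree as far as they are visible
  up to \<open>t\<close>, and each round halves \<open>t\<close>.\<close>

definition matching :: "'g::linordered_idom \<Rightarrow> ('g \<times> 'g) set \<Rightarrow> bool" where
  "matching t R \<longleftrightarrow> (\<forall>(a, b)\<in>R. \<forall>(a', b')\<in>R. clamp t (a - a') = clamp t (b - b'))"

lemma matchingD:
  "matching t R \<Longrightarrow> (a, b) \<in> R \<Longrightarrow> (a', b') \<in> R \<Longrightarrow> clamp t (a - a') = clamp t (b - b')"
  unfolding matching_def by fast

lemma clamp_uminus: "0 \<le> t \<Longrightarrow> clamp t (- z) = - clamp t z"
  unfolding clamp_def by (auto simp: max_def min_def)

lemma clamp_swap:
  assumes "0 \<le> t" "clamp t (a - a') = clamp t (b - b')"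
  shows "clamp t (a' - a) = clamp t (b' - b)"
  using assms clamp_uminus[of t "a - a'"] clamp_uminus[of t "b - b'"] by simp

lemma clamp_eq_mono:
  assumes "0 \<le> s" "s \<le> t" "clamp t x = clamp t y"
  shows "clamp s x = clamp s y"
  using assms unfolding clamp_def max_def min_def by (simp split: if_splits)

lemma matching_mono:
  assumes "matching t R" "0 \<le> s" "s \<le> t"
  shows "matching s R"
  using assms clamp_eq_mono[OF assms(2,3)] unfolding matching_def by fast

lemma matching_converse: "matching t R \<Longrightarrow> matching t (R\<inverse>)"
  unfolding matching_def
proof clarify
  fix b a b' a' assume "(a, b) \<in> R" "(a', b') \<in> R" "\<forall>(a, b)\<in>R. \<forall>(a', b')\<in>R. clamp t (a - a') = clamp t (b - b')"
  then show "clamp t (b - b') = clamp t (a - a')"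
    by fastforce
qed

lemma clamp_eq_neg_iff:
  assumes "0 < t" "clamp t x = clamp t y"
  shows "x < 0 \<longleftrightarrow> y < 0"
  using assms unfolding clamp_def max_def min_def by (simp split: if_splits)

lemma matching_less_iff:
  assumes "matching t R" "0 < t" "(a, b) \<in> R" "(a', b') \<in> R"
  shows "a < a' \<longleftrightarrow> b < b'"
  using clamp_eq_neg_iff[OF assms(2) matchingD[OF assms(1,3,4)]] by simp

text \<open>A shift by at most \<open>t\<close> leaves values at or beyond \<open>2 * t\<close> at
  or beyond \<open>t\<close>; this is why one round costs half the threshold.\<close>

lemma clamp_eq_add:
  assumes "0 < t" "clamp (2 * t) x = clamp (2 * t) y" "- t \<le> d" "d \<le> t"
  shows "clamp t (d + x) = clamp t (d + y)"
  using assms unfolding clamp_def max_def min_def by (simp split: if_splits)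

lemma clamp_eq_if_far:
  "t \<le> x \<Longrightarrow> t \<le> y \<Longrightarrow> clamp t x = clamp t y"
  "0 \<le> t \<Longrightarrow> x \<le> - t \<Longrightarrow> y \<le> - t \<Longrightarrow> clamp t x = clamp t y"
  unfolding clamp_def by (simp_all add: max_def min_def)

lemma matching_insert:
  assumes "matching t R" "0 \<le> t" "\<And>c d. (c, d) \<in> R \<Longrightarrow> clamp t (a - c) = clamp t (b - d)"
  shows "matching t (insert (a, b) R)"
  using assms clamp_swap[OF assms(2) assms(3)] unfolding matching_def by auto

text \<open>If \<open>a\<close> is within \<open>t\<close> of a matched point, the answer copies the
  offset. Otherwise \<open>a\<close> lies far from all matched points, and \<open>c0\<close> ensures
  that some of them are below it.\<close>

lemma matching_extend:
  assumes R: "matching (2 * t) R" "finite R" "0 < t" and c0: "(c0, d0) \<in> R" "c0 \<le> a"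
  shows "\<exists>b. matching t (insert (a, b) R)"
proof (cases "\<exists>(c, d)\<in>R. - t \<le> a - c \<and> a - c \<le> t")
  case True
  then obtain c d where cd: "(c, d) \<in> R" "- t \<le> a - c" "a - c \<le> t"
    by auto
  have "matching t (insert (a, d + (a - c)) R)"
  proof (rule matching_insert)
    fix c' d' assume "(c', d') \<in> R"
    then have "clamp (2 * t) (c - c') = clamp (2 * t) (d - d')"
      by (rule matchingD[OF R(1) cd(1)])
    then have "clamp t ((a - c) + (c - c')) = clamp t ((a - c) + (d - d'))"
      using R(3) cd(2,3) by (intro clamp_eq_add)
    then show "clamp t (a - c') = clamp t (d + (a - c) - d')"
      by (simp add: algebra_simps)
  qed (use R in \<open>auto intro: matching_mono\<close>)
  then show ?thesis by blast
next
  case False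
  then have far: "t < a - c \<or> a - c < - t" if "(c, d) \<in> R" for c d
    using that not_le by blast
  define c where "c = Max {c \<in> fst ` R. c \<le> a}"
  have fin: "finite {c \<in> fst ` R. c \<le> a}" "{c \<in> fst ` R. c \<le> a} \<noteq> {}"
    using R(2) c0 by force+
  have "c \<in> fst ` R" "c \<le> a"
    using Max_in[OF fin] by (auto simp: c_def)
  then obtain d where cd: "(c, d) \<in> R"
    by force
  have max: "c' \<le> c" if "(c', d') \<in> R" "c' \<le> a" for c' d'
    unfolding c_def using that by (intro Max_ge fin(1)) force
  have c: "t < a - c"
    using far[OF cd] \<open>c \<le> a\<close> R(3) by auto
  \<comment> \<open>A matched point above \<open>a\<close> is more than \<open>2 * t\<close> above
    \<open>c\<close>, so its partner is at least \<open>2 * t\<close> above \<open>d\<close>: the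
    answer \<open>d + t\<close> has room \<open>t\<close> on both sides.\<close>
  have "matching t (insert (a, d + t) R)"
  proof (rule matching_insert)
    fix c' d' assume R': "(c', d') \<in> R"
    note less_iff = matching_less_iff[OF R(1) _ cd R'] matching_less_iff[OF R(1) _ R' cd]
    show "clamp t (a - c') = clamp t (d + t - d')"
    proof (cases "c' \<le> a")
      case True
      then have "c' \<le> c"
        using max R' by blast
      then have "d' \<le> d"
        using less_iff R(3) by force
      then show ?thesis
        using c \<open>c' \<le> c\<close> by (intro clamp_eq_if_far(1)) (simp_all add: algebra_simps)
    next
      case False
      then have "a - c' < - t"
        using far[OF R'] R(3) by auto
      then have "2 * t \<le> c' - c"
        using c by (simp add: algebra_simps)
      then have "2 * t \<le> d' - d"
        using matchingD[OF R(1) R' cd] R(3)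
        unfolding clamp_def max_def min_def by (simp split: if_splits)
      then show ?thesis
        using R(3) \<open>a - c' < - t\<close> by (intro clamp_eq_if_far(2)) (simp_all add: algebra_simps)
    qed
  qed (use R in \<open>auto intro: matching_mono\<close>)
  then show ?thesis by blast
qed

section \<open>The game on the posets, where kinds are copied and indices are played\<close>

definition matched :: "('g \<times> 'g) set \<Rightarrow> kind \<times> 'g \<Rightarrow> kind \<times> 'g \<Rightarrow> bool" where
  "matched R x y \<longleftrightarrow> fst x = fst y \<and> (snd x, snd y) \<in> R"

lemma matched_elems:
  assumes "matching t R" "0 < t" "(0, 0) \<in> R" "(M, M') \<in> R" "matched R x y" "x \<in> elems M"
  shows "y \<in> elems M'"
proof -
  have xy: "fst x = fst y" "(snd x, snd y) \<in> R"
    using assms(5) by (auto simp: matched_def)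
  have "snd x < 0 \<longleftrightarrow> snd y < 0" "0 < snd x \<longleftrightarrow> 0 < snd y" "snd x < M \<longleftrightarrow> snd y < M'" "M < snd x \<longleftrightarrow> M' < snd y"
    using matching_less_iff[OF assms(1,2)] xy(2) assms(3,4) by blast+
  then show ?thesis
    using assms(6) xy(1) by (cases x rule: kind_pair_cases; cases y) auto
qed

text \<open>The order only compares indices with each other and with \<open>M\<close>, and a
  matching with positive threshold preserves these comparisons.\<close>

lemma matched_leq_iff:
  assumes "matching t R" "0 < t" "(M, M') \<in> R" "matched R x x'" "matched R y y'"
  shows "leq M x y \<longleftrightarrow> leq M' x' y'"
proof -
  have xy: "fst x = fst x'" "(snd x, snd x') \<in> R" "fst y = fst y'" "(snd y, snd y') \<in> R"
    using assms(4,5) by (auto simp: matched_def)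
  have less: "snd x < snd y \<longleftrightarrow> snd x' < snd y'" "snd y < snd x \<longleftrightarrow> snd y' < snd x'"
    "snd y < M \<longleftrightarrow> snd y' < M'" "M < snd y \<longleftrightarrow> M' < snd y'"
    using matching_less_iff[OF assms(1,2)] xy(2,4) assms(3) by blast+
  then have "snd x = snd y \<longleftrightarrow> snd x' = snd y'" "snd y = M \<longleftrightarrow> snd y' = M'" "snd x \<le> snd y \<longleftrightarrow> snd x' \<le> snd y'"
    by (metis linorder_neq_iff, metis linorder_neq_iff, metis not_le)
  then show ?thesis
    using less xy(1,3) by (cases x rule: kind_pair_cases; cases x'; cases y; cases y') auto
qed

text \<open>Each quantifier halves the threshold, so \<open>2 ^ qdepth \<phi>\<close> leaves 1 for
  atomic formulas. The pairs for 0 and \<open>M\<close> stay in the position like constants.\<close>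

lemma matched_sat_iff:
  assumes "finite R" "matching (2 ^ qdepth \<phi>) R" "(0, 0) \<in> R" "(M, M') \<in> R"
    and "\<And>x. matched R (v x) (w x)" "range v \<subseteq> elems M" "range w \<subseteq> elems M'"
  shows "sat (elems M) (poset_rel M) v \<phi> \<longleftrightarrow> sat (elems M') (poset_rel M') w \<phi>"
  using assms
proof (induction \<phi> arbitrary: R M M' v w)
  case (Leq x y)
  have "matching 1 R"
    using Leq.prems(2) by simp
  then have "leq M (v x) (v y) \<longleftrightarrow> leq M' (w x) (w y)"
    by (rule matched_leq_iff[OF _ zero_less_one Leq.prems(4) Leq.prems(5) Leq.prems(5)])
  moreover have "v x \<in> elems M" "v y \<in> elems M" "w x \<in> elems M'" "w y \<in> elems M'"
    using Leq.prems(6,7) by auto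
  ultimately show ?case
    by (simp add: poset_rel_def)
next
  case (Equal x y)
  have "matching 1 R"
    using Equal.prems(2) by simp
  then have "snd (v x) < snd (v y) \<longleftrightarrow> snd (w x) < snd (w y)" "snd (v y) < snd (v x) \<longleftrightarrow> snd (w y) < snd (w x)"
    by (rule matching_less_iff[OF _ zero_less_one]; use Equal.prems(5) in \<open>simp add: matched_def\<close>)+
  moreover have "fst (v x) = fst (w x)" "fst (v y) = fst (w y)"
    using Equal.prems(5) by (simp_all add: matched_def)
  ultimately show ?case
    by (simp add: prod_eq_iff) (metis linorder_neq_iff)
next
  case (Neg \<phi>)
  have "sat (elems M) (poset_rel M) v \<phi> \<longleftrightarrow> sat (elems M') (poset_rel M') w \<phi>"
    by (rule Neg.IH[OF Neg.prems(1) _ Neg.prems(3-7)]) (use Neg.prems(2) in simp)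
  then show ?case by simp
next
  case (Conj \<phi> \<psi>)
  have m: "matching (2 ^ qdepth \<phi>) R" "matching (2 ^ qdepth \<psi>) R"
    by (rule matching_mono[OF Conj.prems(2)]; simp add: power_increasing)+
  show ?case
    using Conj.IH(1)[OF Conj.prems(1) m(1) Conj.prems(3-7)]
      Conj.IH(2)[OF Conj.prems(1) m(2) Conj.prems(3-7)] by simp
next
  case (Forall x \<phi>)
  let ?t = "2 ^ qdepth \<phi> :: 'a"
  have t: "0 < ?t" by simp
  \<comment> \<open>Stated for arbitrary \<open>N\<close> and \<open>N'\<close> to serve also the
    other player direction, with the converse relation. The pair \<open>(0, 0)\<close> provides the
    matched point below the index of \<open>a\<close>.\<close>
  have step: "\<exists>b R'. finite R' \<and> matching ?t R' \<and> R \<subseteq> R' \<and> b \<in> elems N' \<and> matched R' a b"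
    if R: "finite R" "matching (2 * ?t) R" "(0, 0) \<in> R" "(N, N') \<in> R" and a: "a \<in> elems N"
    for R a and N N' :: 'a
  proof -
    have "0 \<le> snd a"
      using a by (cases a rule: kind_pair_cases) auto
    then obtain b where b: "matching ?t (insert (snd a, b) R)"
      using matching_extend[OF R(2,1) t R(3)] by blast
    have "matched (insert (snd a, b) R) a (fst a, b)"
      by (simp add: matched_def)
    moreover from matched_elems[OF b t _ _ this a] have "(fst a, b) \<in> elems N'"
      using R(3,4) by blast
    ultimately show ?thesis
      using b R(1) by (intro exI[of _ "(fst a, b)"] exI[of _ "insert (snd a, b) R"]) auto
  qed
  have IH: "sat (elems M) (poset_rel M) (v(x := a)) \<phi> \<longleftrightarrow> sat (elems M') (poset_rel M') (w(x := b)) \<phi>"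
    if R': "finite R'" "matching ?t R'" "R \<subseteq> R'" and ab: "a \<in> elems M" "b \<in> elems M'" "matched R' a b" for R' a b
  proof (rule Forall.IH[OF R'(1,2)])
    show "(0, 0) \<in> R'" "(M, M') \<in> R'"
      using R'(3) Forall.prems(3,4) by auto
    show "matched R' ((v(x := a)) y) ((w(x := b)) y)" for y
      using ab(3) Forall.prems(5)[of y] R'(3) by (auto simp: matched_def)
    show "range (v(x := a)) \<subseteq> elems M" "range (w(x := b)) \<subseteq> elems M'"
      using ab Forall.prems(6,7) by auto
  qed
  have m: "matching (2 * ?t) R"
    using Forall.prems(2) by simp
  have "\<exists>b\<in>elems M'. sat (elems M) (poset_rel M) (v(x := a)) \<phi> \<longleftrightarrow> sat (elems M') (poset_rel M') (w(x := b)) \<phi>"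
    if "a \<in> elems M" for a
    using step[OF Forall.prems(1) m Forall.prems(3,4) that] IH that by metis
  moreover have "\<exists>a\<in>elems M. sat (elems M) (poset_rel M) (v(x := a)) \<phi> \<longleftrightarrow> sat (elems M') (poset_rel M') (w(x := b)) \<phi>"
    if b: "b \<in> elems M'" for b
  proof -
    obtain a R' where R': "finite R'" "matching ?t R'" "R\<inverse> \<subseteq> R'" "a \<in> elems M" "matched R' b a"
      using step[of "R\<inverse>" M' M b] Forall.prems(1,3,4) matching_converse[OF m] b by auto
    have "sat (elems M) (poset_rel M) (v(x := a)) \<phi> \<longleftrightarrow> sat (elems M') (poset_rel M') (w(x := b)) \<phi>"
      by (rule IH[of "R'\<inverse>"]) (use R' b in \<open>auto simp: matched_def intro: matching_converse\<close>)
    then show ?thesis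
      using R'(4) by blast
  qed
  ultimately show ?case
    unfolding sat.simps by meson
qed

section \<open>Non-axiomatizability\<close>

instance kind :: countable
  by countable_datatype

text \<open>Integer polynomials are ordered by their values at \<open>\<infinity>\<close>. The interval from \<open>0\<close> to the
  indeterminate is a copy of \<open>\<omega> + \<omega>\<^sup>*\<close>.\<close>

lemma int_poly_discrete:
  fixes g :: "int poly"
  assumes "0 < g"
  shows "1 \<le> g"
proof -
  have lead: "0 < lead_coeff g"
    using assms by (simp add: less_poly_def pos_poly_def)
  show ?thesis
  proof (cases "degree g = 0")
    case True
    then obtain c where "g = [:c:]"
      by (rule degree_eq_zeroE)
    then show ?thesis
      using lead by (auto simp: less_eq_poly_def pos_poly_def one_pCons)
  next
    case False
    \<comment> \<open>Subtracting 1 does not affect the leading term of a non-constant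
      polynomial.\<close>
    then have "degree (g - 1) = degree g"
      using degree_add_eq_left[of "- 1" g] by simp
    then have "lead_coeff (g - 1) = lead_coeff g"
      using False by simp
    then show ?thesis
      using lead by (simp add: less_eq_poly_def pos_poly_def)
  qed
qed

lemma of_nat_less_monom: "of_nat n < (monom 1 1 :: int poly)"
proof -
  have "degree (monom 1 1 - of_nat n :: int poly) = 1"
    using degree_add_eq_left[of "- of_nat n :: int poly" "monom 1 1"]
    by (simp add: degree_monom_eq)
  then show ?thesis
    by (simp add: less_poly_def pos_poly_def of_nat_poly)
qed

text \<open>Coefficient lists show that the element type is countable, so the posets have copies
  over every infinite universe.\<close>

lemma ex_inj_into_infinite:
  assumes "infinite (UNIV :: 'a set)"
  obtains f :: "kind \<times> int poly \<Rightarrow> 'a" where "inj f"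
proof -
  obtain f :: "nat \<Rightarrow> 'a" where "inj f"
    using infinite_countable_subset[OF assms] by blast
  moreover have "inj (\<lambda>x :: kind \<times> int poly. to_nat (fst x, coeffs (snd x)))"
    by (rule injI) (auto simp: prod_eq_iff coeffs_eq_iff)
  ultimately show thesis
    using that inj_compose by blast
qed

text \<open>The game starts with the chain ends matched: the lengths \<open>2 ^ d\<close> and
  \<open>monom 1 1\<close> both clamp to \<open>2 ^ d\<close>, a threshold sufficient for
  \<open>d\<close> rounds.\<close>

lemma models_length_iff:
  assumes "sentence \<phi>" "qdepth \<phi> \<le> d"
  shows "models (elems (2 ^ d :: int poly)) (poset_rel (2 ^ d)) \<phi> \<longleftrightarrow>
    models (elems (monom 1 1 :: int poly)) (poset_rel (monom 1 1)) \<phi>"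
proof -
  let ?M = "2 ^ d :: int poly" and ?X = "monom 1 1 :: int poly"
  let ?v = "\<lambda>_ :: nat. (Base, 0 :: int poly)"
  let ?R = "{(0, 0), (?M, ?X)}"
  have "2 ^ d < ?X"
    using of_nat_less_monom[of "2 ^ d"] by simp
  then have "matching ?M ?R"
    by (auto simp: matching_def clamp_def)
  then have "matching (2 ^ qdepth \<phi>) ?R"
    by (rule matching_mono) (use assms(2) in \<open>simp_all add: power_increasing\<close>)
  then have "sat (elems ?M) (poset_rel ?M) ?v \<phi> \<longleftrightarrow> sat (elems ?X) (poset_rel ?X) ?v \<phi>"
    by (intro matched_sat_iff[of ?R]) (auto simp: matched_def)
  then show ?thesis
    using models_sentence_iff[OF assms(1), of ?v "elems ?M" "poset_rel ?M"]
      models_sentence_iff[OF assms(1), of ?v "elems ?X" "poset_rel ?X"] by simp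
qed

theorem theorem3p12:
  fixes m :: "'b rel" and n :: "'c rel"
  assumes "Card_order m" and "|{..<3::nat}| \<le>o m" and "m \<le>o natLeq"
    and "Card_order n" and "|{..<3::nat}| \<le>o n" and "n \<le>o natLeq"
    and "infinite (UNIV :: 'a set)"
  shows "\<not> finitely_axiomatizable
    (\<lambda>(A :: 'a set) r. partial_order_on A r \<and> representable m n A r)"
proof
  assume "finitely_axiomatizable (\<lambda>(A :: 'a set) r. partial_order_on A r \<and> representable m n A r)"
  then obtain \<Sigma> where \<Sigma>: "finite \<Sigma>" "\<And>\<phi>. \<phi> \<in> \<Sigma> \<Longrightarrow> sentence \<phi>"
    and ax: "\<And>(A :: 'a set) r. fo_structure A r \<Longrightarrow>
      (\<forall>\<phi>\<in>\<Sigma>. models A r \<phi>) \<longleftrightarrow> partial_order_on A r \<and> representable m n A r"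
    unfolding finitely_axiomatizable_def by metis
  obtain d where d: "\<And>\<phi>. \<phi> \<in> \<Sigma> \<Longrightarrow> qdepth \<phi> \<le> d"
    using \<Sigma>(1) by (metis Max_ge finite_imageI imageI)
  obtain f :: "kind \<times> int poly \<Rightarrow> 'a" where f: "inj f"
    using ex_inj_into_infinite[OF assms(7)] .
  have f': "inj_on f A" for A
    using f by (rule inj_on_subset) simp
  have base: "(Base, 0) \<in> elems M" for M :: "int poly"
    by simp
  \<comment> \<open>The assumed axiomatization speaks about carriers in \<open>'a\<close>; applied
    to images under \<open>f\<close>, it decides representability of the original posets.\<close>
  have ax': "(\<forall>\<phi>\<in>\<Sigma>. models (elems M) (poset_rel M) \<phi>) \<longleftrightarrow> representable m n (elems M) (poset_rel M)"
    for M :: "int poly"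
  proof -
    have nonempty: "elems M \<noteq> {}"
      using base by blast
    have "fo_structure (f ` elems M) (map_prod f f ` poset_rel M)"
      using poset_rel_subset[of M] nonempty unfolding fo_structure_def by auto
    from ax[OF this] show ?thesis
      using models_image[OF f \<Sigma>(2) base[of M], of _ "poset_rel M"]
        partial_order_on_image[OF f partial_order_poset_rel[of M]]
        representable_image_iff[OF f' poset_rel_subset[of M], of m n] by simp
  qed
  let ?X = "monom 1 1 :: int poly"
  have "representable m n (elems ?X) (poset_rel ?X)"
    by (rule representable_infinite[OF int_poly_discrete of_nat_less_monom assms(3,6)])
  then have "\<forall>\<phi>\<in>\<Sigma>. models (elems ?X) (poset_rel ?X) \<phi>"
    using ax' by blast
  then have "\<forall>\<phi>\<in>\<Sigma>. models (elems (2 ^ d :: int poly)) (poset_rel (2 ^ d)) \<phi>"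
    using models_length_iff[OF \<Sigma>(2) d] by blast
  then have "representable m n (elems (2 ^ d :: int poly)) (poset_rel (2 ^ d))"
    using ax' by blast
  moreover have "\<not> representable m n (elems (of_nat (2 ^ d) :: int poly)) (poset_rel (of_nat (2 ^ d)))"
    by (rule not_representable_of_nat[OF int_poly_discrete _ assms(2,5)]) simp_all
  ultimately show False
    by simp
qed

end
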